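(* Let $m$ be a year, let the stack-replacement decision $\bar z_m$ and the initial efficiency state $\bar L_{m-1}$ be fixed, and let $\mathcal{C}_m$ be a partition of the time periods of year $m$ into chronologically ordered clusters. Let $\Omega_m = d_m^\top x_m$ be the optimal objective value of the operational subproblem of year $m$, and let $\hat\Omega_m = \sum_{c\in\mathcal{C}_m} \hat d_c^\top \hat x_c$ be the optimal objective value of the aggregate subproblem of year $m$ over the set of clusters $\mathcal{C}_m$ (both problems as defined in the context). If the aggregate price parameter is defined as the local minimum price within each cluster, i.e. $\hat\psi^E_c = \min_{t\in c}\psi^E_t$ for all $c\in\mathcal{C}_m$, then the aggregate subproblem produces a valid lower bound on the original subproblem: $\hat\Omega_m \le \Omega_m$.
   Context: Setting: an electrolyzer buys electricity and sells hydrogen over a horizon of $N$ years; $m\in\{1,\dots,N\}$ indexes years. Operational subproblem of year $m$. Let $T_m$ be the finite, linearly ordered set of time periods of year $m$. For each $t\in T_m$ there is a vector $x_t$ of binary and continuous operation variables, $x_t\in\{0,1\}^4\times\mathbb{R}^4$; write $x_m=(x_t)_{t\in T_m}$. Among the components of $x_t$ are the power (electricity) consumption $e_t\ge 0$ and the hydrogen production $h_t$. For a fixed replacement decision $\bar z_m$ and fixed initial efficiency state $\bar L_{m-1}$, the subproblem is $$\Omega_m=\Omega_m(\bar z_m,\bar L_{m-1})=\min_{x_m}\; d_m^\top x_m\quad\text{s.t.}\quad A_m x_m\le b_m-G_m\bar z_m,\quad L_m x_m=\bar L_{m-1},\quad x_t\in\{0,1\}^4\times\mathbb{R}^4\ \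 (t\in T_m),$$ with given real data $A_m,b_m,G_m,L_m$ (the constraints model hydrogen production, electricity consumption, daily hydrogen demand, operation logic and efficiency state, and include $e_t\ge 0$). The objective is the discounted electricity expense minus hydrogen revenue: $$d_m^\top x_m=\frac{1}{(1+\rho)^m}\sum_{t\in T_m}\left(\psi^E_t e_t-\psi^H h_t\right),$$ where $\psi^E_t\in\mathbb{R}$ is the electricity market price in period $t$, $\psi^H\in\mathbb{R}$ is the hydrogen price, and $\rho$ is the annual discount rate, with $\frac{1}{(1+\rho)^m}\ge 0$. Aggregate subproblem of year $m$. Let $\mathcal{C}_m$ be a partition of $T_m$ into nonempty chronologically ordered clusters. For each $c\in\mathcal{C}_m$ there is a real (continuous) vector of aggregate variables $\hat x_c$, corresponding to the aggregation $\hat x_c=\sum_{t\in c}x_t$; in particular its components $\hat e_c$ and $\hat h_c$ correspond to $\sum_{t\in c}e_t$ and $\sum_{t\in c}h_t$. The aggregate subproblem minimizes $$\sum_{c\in\mathcal{C}_m}\hat d_c^\top\hat x_c=\frac{1}{(1+\rho)^m}\sum_{c\in\mathcal{C}_m}\left(\hat\psi^E_c\,\hat e_c-\psi^H\hat h_c\right)$$ over real vectors $(\hat x_c)_{c\in\mathcal{C}_m}$ in a feasible set $\hat X_m$ given by linear aggregate constraints (of the form $\hat A_c\hat x_c+G_c \bar z_m\le\hat b_c$ for $c\in\mathcal{C}_m$, together with linear equalities linking the efficiency states of consecutive clusters), for the same fixed $\bar z_m$ and $\bar L_{m-1}$. Its optimal value is $\hat\Omega_m$. Standing assumption: the aggregation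 is a valid relaxation of the feasible space, i.e. for every $x_m=(x_t)_{t\in T_m}$ feasible for the operational subproblem, the aggregated point $\left(\sum_{t\in c}x_t\right)_{c\in\mathcal{C}_m}$ belongs to $\hat X_m$. Both problems are assumed to attain their optimal values. *)

theory Defs
  imports "HOL-Analysis.Analysis" "HOL-Library.Disjoint_Sets"
begin

text \<open>
  A vector of \<open>{0,1}\<^sup>4 \<times> \<real>\<^sup>4\<close> is an element of \<open>real^(4+4)\<close>: the \<open>Inl\<close> coordinates are the binary
  ones (this is required in the feasible set below), the \<open>Inr\<close> coordinates the continuous ones.
  Which continuous coordinates hold the power consumption and the hydrogen production is part of
  the data.

  A year's variable \<open>(x\<^sub>t)\<close> is a function on periods of which only the values on \<open>periods\<close> matter;
  likewise an aggregate variable is a function on clusters. A matrix acting on a year's variable is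
  given by its blocks, one for each period.
\<close>

record ('t, 'r, 'z, 'l) op_problem =
  year :: nat
  periods :: "'t set"
  power_ix :: "4"
  hydrogen_ix :: "4"
  op_A :: "'t \<Rightarrow> real^(4+4)^'r::finite"
  op_b :: "real^'r::finite"
  op_G :: "real^'z::finite^'r::finite"
  op_L :: "'t \<Rightarrow> real^(4+4)^'l::finite"
  elec_price :: "'t \<Rightarrow> real"
  hydrogen_price :: real
  disc_rate :: real

definition discount :: "('t, 'r::finite, 'z::finite, 'l::finite) op_problem \<Rightarrow> real" where
  "discount P = 1 / (1 + disc_rate P) ^ year P"

definition power_cons :: "('t, 'r::finite, 'z::finite, 'l::finite) op_problem \<Rightarrow> real^(4+4) \<Rightarrow> real" where
  "power_cons P v = v $ Inr (power_ix P)"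

definition hydrogen_prod :: "('t, 'r::finite, 'z::finite, 'l::finite) op_problem \<Rightarrow> real^(4+4) \<Rightarrow> real" where
  "hydrogen_prod P v = v $ Inr (hydrogen_ix P)"

definition cost_vec ::
  "('t, 'r::finite, 'z::finite, 'l::finite) op_problem \<Rightarrow> real \<Rightarrow> real^(4+4)" where
  "cost_vec P \<psi> = discount P *\<^sub>R
     (axis (Inr (power_ix P)) \<psi> - axis (Inr (hydrogen_ix P)) (hydrogen_price P))"

lemma cost_vec_inner:
  "cost_vec P \<psi> \<bullet> v = discount P * (\<psi> * power_cons P v - hydrogen_price P * hydrogen_prod P v)"
  by (simp add: cost_vec_def power_cons_def hydrogen_prod_def inner_diff_left inner_axis')

definition op_objective ::
  "('t, 'r::finite, 'z::finite, 'l::finite) op_problem \<Rightarrow> ('t \<Rightarrow> real^(4+4)) \<Rightarrow> real" where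
  "op_objective P x = (\<Sum>t\<in>periods P. cost_vec P (elec_price P t) \<bullet> x t)"

lemma op_objective_eq:
  "op_objective P x = 1 / (1 + disc_rate P) ^ year P *
     (\<Sum>t\<in>periods P. elec_price P t * power_cons P (x t) - hydrogen_price P * hydrogen_prod P (x t))"
  by (simp only: op_objective_def cost_vec_inner discount_def sum_distrib_left)

definition op_feasible ::
  "('t, 'r::finite, 'z::finite, 'l::finite) op_problem \<Rightarrow> real^'z \<Rightarrow> real^'l
     \<Rightarrow> ('t \<Rightarrow> real^(4+4)) set" where
  "op_feasible P z Lbar = {x.
     (\<Sum>t\<in>periods P. op_A P t *v x t) \<le> op_b P - op_G P *v z \<and>
     (\<Sum>t\<in>periods P. op_L P t *v x t) = Lbar \<and>
     (\<forall>t\<in>periods P. \<forall>i. x t $ Inl i \<in> {0, 1})}"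

definition opt_value :: "('a \<Rightarrow> real) \<Rightarrow> 'a set \<Rightarrow> real" where
  "opt_value f X = (INF x\<in>X. f x)"

definition attains_min :: "('a \<Rightarrow> real) \<Rightarrow> 'a set \<Rightarrow> bool" where
  "attains_min f X \<longleftrightarrow> (\<exists>x. is_arg_min f (\<lambda>y. y \<in> X) x)"

lemma opt_value_eq:
  assumes "is_arg_min f (\<lambda>y. y \<in> X) x"
  shows "opt_value f X = f x"
  unfolding opt_value_def
  by (rule cInf_eq_minimum) (use assms in \<open>auto simp: is_arg_min_linorder\<close>)

definition Omega ::
  "('t, 'r::finite, 'z::finite, 'l::finite) op_problem \<Rightarrow> real^'z \<Rightarrow> real^'l \<Rightarrow> real" where
  "Omega P z Lbar = opt_value (op_objective P) (op_feasible P z Lbar)"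

definition precedes :: "'t::linorder set \<Rightarrow> 't set \<Rightarrow> bool" where
  "precedes c c' \<longleftrightarrow> (\<forall>s\<in>c. \<forall>t\<in>c'. s < t)"

definition chronological_partition :: "'t::linorder set \<Rightarrow> 't set set \<Rightarrow> bool" where
  "chronological_partition T C \<longleftrightarrow> partition_on T C \<and>
     (\<forall>c\<in>C. \<forall>c'\<in>C. c \<noteq> c' \<longrightarrow> precedes c c' \<or> precedes c' c)"

definition first_cluster :: "'t::linorder set set \<Rightarrow> 't set \<Rightarrow> bool" where
  "first_cluster C c \<longleftrightarrow> c \<in> C \<and> (\<forall>c'\<in>C. c' \<noteq> c \<longrightarrow> precedes c c')"

definition consecutive :: "'t::linorder set set \<Rightarrow> 't set \<Rightarrow> 't set \<Rightarrow> bool" where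
  "consecutive C c c' \<longleftrightarrow> c \<in> C \<and> c' \<in> C \<and> precedes c c' \<and>
     \<not> (\<exists>d\<in>C. precedes c d \<and> precedes d c')"

text \<open>
  The efficiency state at the start of a cluster \<open>c\<close> enters through \<open>link_in c\<close>, the one handed on
  to the next cluster through \<open>link_out c\<close>; \<open>link_init\<close> plays the role of \<open>link_out\<close> for the state
  at the beginning of the year. All matrices and offsets are arbitrary.
\<close>

record ('t, 'q, 'z, 'l, 'k) agg_problem =
  clusters :: "'t set set"
  agg_A :: "'t set \<Rightarrow> real^(4+4)^'q::finite"
  agg_G :: "'t set \<Rightarrow> real^'z::finite^'q::finite"
  agg_b :: "'t set \<Rightarrow> real^'q::finite"
  link_in :: "'t set \<Rightarrow> real^(4+4)^'k::finite"
  link_out :: "'t set \<Rightarrow> real^(4+4)^'k::finite"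
  link_init :: "real^'l::finite^'k::finite"
  link_offset :: "'t set \<Rightarrow> real^'k::finite"
  agg_price :: "'t set \<Rightarrow> real"

definition agg_feasible ::
  "('t::linorder, 'q::finite, 'z::finite, 'l::finite, 'k::finite) agg_problem \<Rightarrow> real^'z \<Rightarrow> real^'l
     \<Rightarrow> ('t set \<Rightarrow> real^(4+4)) set" where
  "agg_feasible Q z Lbar = {xh.
     (\<forall>c\<in>clusters Q. agg_A Q c *v xh c + agg_G Q c *v z \<le> agg_b Q c) \<and>
     (\<forall>c. first_cluster (clusters Q) c \<longrightarrow>
        link_in Q c *v xh c = link_init Q *v Lbar + link_offset Q c) \<and>
     (\<forall>c c'. consecutive (clusters Q) c c' \<longrightarrow>
        link_in Q c' *v xh c' = link_out Q c *v xh c + link_offset Q c')}"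

definition agg_objective ::
  "('t, 'r::finite, 'z::finite, 'l::finite) op_problem \<Rightarrow>
   ('t, 'q::finite, 'z, 'l, 'k::finite) agg_problem \<Rightarrow> ('t set \<Rightarrow> real^(4+4)) \<Rightarrow> real" where
  "agg_objective P Q xh = (\<Sum>c\<in>clusters Q. cost_vec P (agg_price Q c) \<bullet> xh c)"

lemma agg_objective_eq:
  "agg_objective P Q xh = 1 / (1 + disc_rate P) ^ year P *
     (\<Sum>c\<in>clusters Q. agg_price Q c * power_cons P (xh c) - hydrogen_price P * hydrogen_prod P (xh c))"
  by (simp only: agg_objective_def cost_vec_inner discount_def sum_distrib_left)

definition Omega_hat ::
  "('t::linorder, 'r::finite, 'z::finite, 'l::finite) op_problem \<Rightarrow>
   ('t, 'q::finite, 'z, 'l, 'k::finite) agg_problem \<Rightarrow> real^'z \<Rightarrow> real^'l \<Rightarrow> real" where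
  "Omega_hat P Q z Lbar = opt_value (agg_objective P Q) (agg_feasible Q z Lbar)"

definition aggregate :: "('t \<Rightarrow> real^(4+4)) \<Rightarrow> 't set \<Rightarrow> real^(4+4)" where
  "aggregate x c = (\<Sum>t\<in>c. x t)"

end

(* Aggregating an operational optimum gives a feasible aggregate point. Since power consumption is
   nonnegative and every cluster is charged its lowest price, this point costs at most the
   operational optimum, and the aggregate optimum costs no more than this point. *)
theory Submission
  imports Defs
begin

text \<open>The price enters only through the electricity term, where it is multiplied by the
  nonnegative factor \<open>discount P * power_cons P v\<close>; the hydrogen term cancels.\<close>

lemma cost_vec_inner_mono:
  assumes "discount P \<ge> 0" "power_cons P v \<ge> 0" "\<psi> \<le> \<psi>'"
  shows "cost_vec P \<psi> \<bullet> v \<le> cost_vec P \<psi>' \<bullet> v"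
  unfolding cost_vec_inner
  by (intro mult_left_mono diff_right_mono mult_right_mono assms)

text \<open>Both objectives split into one term per period, because a cluster's price is constant on
  it and the clusters partition the year; the terms are then compared one by one.\<close>

lemma agg_objective_aggregate_le:
  fixes P :: "('t::linorder, 'r::finite, 'z::finite, 'l::finite) op_problem"
    and Q :: "('t, 'q::finite, 'z, 'l, 'k::finite) agg_problem"
  assumes fin: "finite (periods P)"
    and disc: "discount P \<ge> 0"
    and pow: "\<And>t. t \<in> periods P \<Longrightarrow> power_cons P (x t) \<ge> 0"
    and part: "partition_on (periods P) (clusters Q)"
    and price: "\<And>c t. c \<in> clusters Q \<Longrightarrow> t \<in> c \<Longrightarrow> agg_price Q c \<le> elec_price P t"
  shows "agg_objective P Q (aggregate x) \<le> op_objective P x"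
proof -
  have union: "\<Union>(clusters Q) = periods P"
    using part by (simp add: partition_on_def)
  have "agg_objective P Q (aggregate x)
      = (\<Sum>c\<in>clusters Q. \<Sum>t\<in>c. cost_vec P (agg_price Q c) \<bullet> x t)"
    by (simp add: agg_objective_def aggregate_def inner_sum_right)
  \<comment> \<open>\<open>union\<close> places each \<open>t\<close> of a cluster in
    \<open>periods P\<close>, where \<open>pow\<close> applies.\<close>
  also have "\<dots> \<le> (\<Sum>c\<in>clusters Q. \<Sum>t\<in>c. cost_vec P (elec_price P t) \<bullet> x t)"
    using union by (intro sum_mono cost_vec_inner_mono disc pow price) auto
  \<comment> \<open>Disjointness of the clusters ensures that each period is counted once.\<close>
  also have "\<dots> = (\<Sum>t\<in>\<Union>(clusters Q). cost_vec P (elec_price P t) \<bullet> x t)"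
    using fin part
    by (subst sum.Union_disjoint)
       (auto simp: partition_on_def disjoint_def intro: finite_subset)
  also have "\<dots> = op_objective P x"
    by (simp add: union op_objective_def)
  finally show ?thesis .
qed

theorem theorem1:
  fixes N :: nat
    and P :: "('t::linorder, 'r::finite, 'z::finite, 'l::finite) op_problem"
    and Q :: "('t, 'q::finite, 'z, 'l, 'k::finite) agg_problem"
    and zbar :: "real^'z" and Lbar :: "real^'l"
  assumes "year P \<in> {1..N}"
    and "finite (periods P)"
    and "power_ix P \<noteq> hydrogen_ix P"
    and "1 / (1 + disc_rate P) ^ year P \<ge> 0"
    and power_nonneg: "\<forall>x \<in> op_feasible P zbar Lbar. \<forall>t \<in> periods P. power_cons P (x t) \<ge> 0"
    and "chronological_partition (periods P) (clusters Q)"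
    and relaxation: "\<forall>x \<in> op_feasible P zbar Lbar. aggregate x \<in> agg_feasible Q zbar Lbar"
    and "attains_min (op_objective P) (op_feasible P zbar Lbar)"
    and "attains_min (agg_objective P Q) (agg_feasible Q zbar Lbar)"
    and price: "\<forall>c \<in> clusters Q. agg_price Q c = Min (elec_price P ` c)"
  shows "Omega_hat P Q zbar Lbar \<le> Omega P zbar Lbar"
proof -
  obtain x where x: "is_arg_min (op_objective P) (\<lambda>y. y \<in> op_feasible P zbar Lbar) x"
    using assms(8) by (auto simp: attains_min_def)
  obtain xh where xh: "is_arg_min (agg_objective P Q) (\<lambda>y. y \<in> agg_feasible Q zbar Lbar) xh"
    using assms(9) by (auto simp: attains_min_def)
  have feas: "x \<in> op_feasible P zbar Lbar"
    using x by (simp add: is_arg_min_def)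
  have part: "partition_on (periods P) (clusters Q)"
    using assms(6) by (simp add: chronological_partition_def)
  have min_price: "agg_price Q c \<le> elec_price P t" if "c \<in> clusters Q" "t \<in> c" for c t
  proof -
    \<comment> \<open>This makes \<open>c\<close> finite, so that \<open>Min\<close> really is a
      lower bound for the prices in \<open>c\<close>.\<close>
    have "c \<subseteq> periods P"
      using part that(1) by (auto simp: partition_on_def)
    then show ?thesis
      using that price finite_subset[OF _ assms(2)] by simp
  qed
  \<comment> \<open>The infimum in \<open>opt_value\<close> equals the objective at the minimizer
    \<open>xh\<close>.\<close>
  have "Omega_hat P Q zbar Lbar = agg_objective P Q xh"
    unfolding Omega_hat_def using xh by (rule opt_value_eq)
  \<comment> \<open>By \<open>relaxation\<close>, \<open>aggregate x\<close> competes with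
    \<open>xh\<close>.\<close>
  also have "\<dots> \<le> agg_objective P Q (aggregate x)"
    using xh relaxation feas by (auto simp: is_arg_min_linorder)
  also have "\<dots> \<le> op_objective P x"
    using assms(2,4) power_nonneg feas part min_price
    by (intro agg_objective_aggregate_le) (auto simp: discount_def)
  also have "\<dots> = Omega P zbar Lbar"
    unfolding Omega_def using x by (rule opt_value_eq[symmetric])
  finally show ?thesis .
qed

end
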